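(* The following decision problem subsumes the analytical hierarchy (every set $X\subseteq\mathbb N$ in $\Sigma^1_n$ or $\Pi^1_n$ for some $n$ is many-one reducible to it): given equational bitstream specifications $E_s$ over $\Sigma_s$ and $E_t$ over $\Sigma_t$ and ground terms $s$ over $\Sigma_s$ and $t$ over $\Sigma_t$, both of sort $S$, decide whether $\mathrm{sol}_{\mathrm{full}}(s,E_s)=\mathrm{sol}_{\mathrm{full}}(t,E_t)$.
   Context: Sorts are $B$ (bits) and $S$ (bitstreams). A bitstream signature $\Sigma$ is a set of function symbols, each with a type $f :: s_1\times\cdots\times s_n\to s$ with $s_i,s\in\{B,S\}$, containing $0,1::B$ and the infix stream constructor $:\,::B\times S\to S$. An equational bitstream specification over $\Sigma$ is a finite set of equations between sorted terms of the same sort (terms may contain sorted variables). A stream algebra $\mathcal{A}=\langle A,[\![\cdot]\!]\rangle$ consists of $A_B=\{0,1\}$, a nonempty $A_S\subseteq\{0,1\}^{\mathbb N}$, and functions $[\![f]\!]:A_{s_1}\times\cdots\times A_{s_n}\to A_s$ for each symbol, with $[\![:]\!](x,\sigma)=x:\sigma$, $[\![0]\!]=0$, $[\![1]\!]=1$. $\mathcal A$ is a model of $E$ if both sides of every equation of $E$ have equal interpretations under every sort-respecting variable assignment into $A$; $\mathcal A$ is full if $A_S=\{0,1\}^{\mathbb N}$. For a ground term $s$ of sort $S$, $\mathrm{sol}_{\mathrm{full}}(s,E)=\{[\![s]\!]^{\mathcal A}\mid \mathcal A\text{ full},\ \mathcal A\text{ a model of }E\}$. Instances are coded as natural numbers;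 many-one reductions are by partial recursive functions. *)

theory Defs
  imports "HOL-Library.Stream" "HOL-Library.Nat_Bijection"
begin

section \<open>Bitstream signatures, terms and specifications\<close>

datatype bsort = Bit | Str

text \<open>The first three symbols are the mandatory \<open>0\<close>, \<open>1\<close> and \<open>:\<close>; all other symbols are
  taken from a countable supply. A signature is a partial map from symbols to types.\<close>

datatype fsym = Bit0 | Bit1 | SCon | Fn nat

type_synonym ftype = "bsort list \<times> bsort"
type_synonym signat = "fsym \<Rightarrow> ftype option"

definition bitstream_signature :: "signat \<Rightarrow> bool" where
  "bitstream_signature \<Sigma> \<longleftrightarrow>
     \<Sigma> Bit0 = Some ([], Bit) \<and> \<Sigma> Bit1 = Some ([], Bit) \<and> \<Sigma> SCon = Some ([Bit, Str], Str)"

datatype bterm = Var bsort nat | App fsym "bterm list"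

inductive has_sort :: "signat \<Rightarrow> bterm \<Rightarrow> bsort \<Rightarrow> bool" for \<Sigma> :: signat where
  Var: "has_sort \<Sigma> (Var s x) s"
| App: "\<Sigma> f = Some (ss, s) \<Longrightarrow> list_all2 (has_sort \<Sigma>) ts ss \<Longrightarrow> has_sort \<Sigma> (App f ts) s"

fun tvars :: "bterm \<Rightarrow> (bsort \<times> nat) set" where
  "tvars (Var s x) = {(s, x)}"
| "tvars (App f ts) = (\<Union>t\<in>set ts. tvars t)"

definition ground_term :: "signat \<Rightarrow> bterm \<Rightarrow> bsort \<Rightarrow> bool" where
  "ground_term \<Sigma> t s \<longleftrightarrow> has_sort \<Sigma> t s \<and> tvars t = {}"

definition bitstream_spec :: "signat \<Rightarrow> (bterm \<times> bterm) set \<Rightarrow> bool" where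
  "bitstream_spec \<Sigma> E \<longleftrightarrow>
     finite E \<and> (\<forall>(l, r)\<in>E. \<exists>s. has_sort \<Sigma> l s \<and> has_sort \<Sigma> r s)"

section \<open>Stream algebras and solutions\<close>

text \<open>Bits are rendered as \<^typ>\<open>bool\<close>, with \<^term>\<open>False\<close> for \<open>0\<close> and \<^term>\<open>True\<close> for \<open>1\<close>.
  The type \<open>val\<close> is the disjoint union of the two sorts, so that one interpretation
  function covers symbols of every type. Its values on symbols outside the signature and on
  argument lists outside the declared domain are irrelevant.\<close>

datatype val = BitV bool | StrV "bool stream"

record stream_alg =
  strs :: "bool stream set"
  interp :: "fsym \<Rightarrow> val list \<Rightarrow> val"

fun sort_dom :: "stream_alg \<Rightarrow> bsort \<Rightarrow> val set" where
  "sort_dom A Bit = range BitV"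
| "sort_dom A Str = StrV ` strs A"

definition stream_algebra :: "signat \<Rightarrow> stream_alg \<Rightarrow> bool" where
  "stream_algebra \<Sigma> A \<longleftrightarrow>
     strs A \<noteq> {} \<and>
     (\<forall>f ss s vs. \<Sigma> f = Some (ss, s) \<longrightarrow> list_all2 (\<lambda>v s'. v \<in> sort_dom A s') vs ss \<longrightarrow>
        interp A f vs \<in> sort_dom A s) \<and>
     interp A Bit0 [] = BitV False \<and>
     interp A Bit1 [] = BitV True \<and>
     (\<forall>x. \<forall>\<sigma>\<in>strs A. interp A SCon [BitV x, StrV \<sigma>] = StrV (x ## \<sigma>))"

definition assignment :: "stream_alg \<Rightarrow> (bsort \<Rightarrow> nat \<Rightarrow> val) \<Rightarrow> bool" where
  "assignment A \<rho> \<longleftrightarrow> (\<forall>s x. \<rho> s x \<in> sort_dom A s)"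

fun teval :: "stream_alg \<Rightarrow> (bsort \<Rightarrow> nat \<Rightarrow> val) \<Rightarrow> bterm \<Rightarrow> val" where
  "teval A \<rho> (Var s x) = \<rho> s x"
| "teval A \<rho> (App f ts) = interp A f (map (teval A \<rho>) ts)"

definition model :: "stream_alg \<Rightarrow> (bterm \<times> bterm) set \<Rightarrow> bool" where
  "model A E \<longleftrightarrow> (\<forall>(l, r)\<in>E. \<forall>\<rho>. assignment A \<rho> \<longrightarrow> teval A \<rho> l = teval A \<rho> r)"

definition full :: "stream_alg \<Rightarrow> bool" where
  "full A \<longleftrightarrow> strs A = UNIV"

text \<open>For ground \<open>t\<close> the choice of \<open>\<rho>\<close> below is immaterial, and for \<open>t\<close> of sort \<open>Str\<close> all
  elements are of the form \<^term>\<open>StrV \<sigma>\<close>.\<close>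

definition sol_full :: "signat \<Rightarrow> bterm \<Rightarrow> (bterm \<times> bterm) set \<Rightarrow> val set" where
  "sol_full \<Sigma> t E =
     {teval A \<rho> t | A \<rho>. stream_algebra \<Sigma> A \<and> full A \<and> model A E \<and> assignment A \<rho>}"

lemma teval_ground: "tvars t = {} \<Longrightarrow> teval A \<rho> t = teval A \<rho>' t"
  by (induction t) (auto intro!: arg_cong[where f = "interp A _"])

lemma teval_in_sort_dom:
  assumes "stream_algebra \<Sigma> A" "assignment A \<rho>" "has_sort \<Sigma> t s"
  shows "teval A \<rho> t \<in> sort_dom A s"
  using assms(3)
proof (induction rule: has_sort.induct)
  case (Var s x)
  then show ?case using assms(2) by (simp add: assignment_def)
next
  case (App f ss s ts)
  then have "list_all2 (\<lambda>v s'. v \<in> sort_dom A s') (map (teval A \<rho>) ts) ss"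
    by (auto simp: list_all2_conv_all_nth)
  with App assms(1) show ?case
    unfolding stream_algebra_def teval.simps by blast
qed

section \<open>The decision problem on natural numbers\<close>

text \<open>An instance half consists of a finite signature (as an association list), a finite list
  of equations and a term.\<close>

type_synonym half = "(fsym \<times> ftype) list \<times> (bterm \<times> bterm) list \<times> bterm"

fun valid_half :: "half \<Rightarrow> bool" where
  "valid_half (fs, es, t) \<longleftrightarrow>
     bitstream_signature (map_of fs) \<and> bitstream_spec (map_of fs) (set es) \<and>
     ground_term (map_of fs) t Str"

fun half_sol :: "half \<Rightarrow> val set" where
  "half_sol (fs, es, t) = sol_full (map_of fs) t (set es)"

fun sort_code :: "bsort \<Rightarrow> nat" where
  "sort_code Bit = 0"
| "sort_code Str = 1"

fun fsym_code :: "fsym \<Rightarrow> nat" where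
  "fsym_code Bit0 = 0"
| "fsym_code Bit1 = 1"
| "fsym_code SCon = 2"
| "fsym_code (Fn k) = k + 3"

fun ftype_code :: "ftype \<Rightarrow> nat" where
  "ftype_code (ss, s) = prod_encode (list_encode (map sort_code ss), sort_code s)"

fun term_code :: "bterm \<Rightarrow> nat" where
  "term_code (Var s x) = sum_encode (Inl (prod_encode (sort_code s, x)))"
| "term_code (App f ts) =
     sum_encode (Inr (prod_encode (fsym_code f, list_encode (map term_code ts))))"

fun decl_code :: "fsym \<times> ftype \<Rightarrow> nat" where
  "decl_code (f, \<tau>) = prod_encode (fsym_code f, ftype_code \<tau>)"

fun eqn_code :: "bterm \<times> bterm \<Rightarrow> nat" where
  "eqn_code (l, r) = prod_encode (term_code l, term_code r)"

fun half_code :: "half \<Rightarrow> nat" where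
  "half_code (fs, es, t) =
     prod_encode (list_encode (map decl_code fs),
       prod_encode (list_encode (map eqn_code es), term_code t))"

definition instance_code :: "half \<times> half \<Rightarrow> nat" where
  "instance_code = (\<lambda>(I, J). prod_encode (half_code I, half_code J))"

lemma inj_sort_code: "inj sort_code"
proof (rule injI)
  fix s t assume "sort_code s = sort_code t"
  then show "s = t" by (cases s; cases t) auto
qed

lemma inj_fsym_code: "inj fsym_code"
proof (rule injI)
  fix f g assume "fsym_code f = fsym_code g"
  then show "f = g" by (cases f; cases g) auto
qed

lemma inj_ftype_code: "inj ftype_code"
  by (auto intro!: injI simp: list_encode_eq inj_map_eq_map[OF inj_sort_code]
      inj_eq[OF inj_sort_code])

lemma inj_term_code: "inj term_code"
proof (rule injI)
  show "t = u" if "term_code t = term_code u" for t u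
    using that
  proof (induction t arbitrary: u)
    case (Var s x)
    then show ?case
      by (cases u) (auto simp: sum_encode_eq inj_eq[OF inj_sort_code])
  next
    case (App f ts)
    then obtain us where u: "u = App f us" and m: "map term_code ts = map term_code us"
      by (cases u) (auto simp: sum_encode_eq list_encode_eq inj_eq[OF inj_fsym_code])
    have "ts = us"
      using m App.IH by (auto simp: list_eq_iff_nth_eq)
    with u show ?case by simp
  qed
qed

lemma inj_decl_code: "inj decl_code"
  by (auto intro!: injI simp: inj_eq[OF inj_fsym_code] simp del: ftype_code.simps
      dest: injD[OF inj_ftype_code])

lemma inj_eqn_code: "inj eqn_code"
  by (auto intro!: injI simp: inj_eq[OF inj_term_code])

lemma inj_half_code: "inj half_code"
  by (auto intro!: injI simp: list_encode_eq inj_map_eq_map[OF inj_decl_code]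
      inj_map_eq_map[OF inj_eqn_code] inj_eq[OF inj_term_code])

lemma inj_instance_code: "inj instance_code"
  by (auto intro!: injI simp: instance_code_def simp del: half_code.simps
      dest: injD[OF inj_half_code])

definition full_sol_equality :: "nat set" where
  "full_sol_equality =
     {instance_code (I, J) | I J. valid_half I \<and> valid_half J \<and> half_sol I = half_sol J}"

section \<open>Partial recursive functions and many-one reducibility\<close>

datatype recf =
    RZero
  | RSucc
  | RProj nat
  | RComp recf "recf list"
  | RPrim recf recf
  | RMin recf

text \<open>Arities are implicit: on inputs of each fixed length, a \<^typ>\<open>recf\<close> denotes a partial
  recursive function of that arity. Composition is strict. Unbounded minimization requires all
  values before the first zero to be defined.\<close>

fun reval :: "recf \<Rightarrow> nat list \<Rightarrow> nat option" where
  "reval RZero xs = Some 0"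
| "reval RSucc xs = (case xs of [x] \<Rightarrow> Some (Suc x) | _ \<Rightarrow> None)"
| "reval (RProj i) xs = (if i < length xs then Some (xs ! i) else None)"
| "reval (RComp f gs) xs = Option.bind (those (map (\<lambda>g. reval g xs) gs)) (reval f)"
| "reval (RPrim f g) xs =
     (case xs of [] \<Rightarrow> None
      | n # ys \<Rightarrow>
          rec_nat (reval f ys) (\<lambda>k r. Option.bind r (\<lambda>v. reval g (k # v # ys))) n)"
| "reval (RMin f) xs =
     (if \<exists>n. reval f (n # xs) = Some 0 \<and> (\<forall>m<n. reval f (m # xs) \<noteq> None)
      then Some (LEAST n. reval f (n # xs) = Some 0) else None)"

definition partial_recursive :: "(nat \<Rightarrow> nat option) \<Rightarrow> bool" where
  "partial_recursive f \<longleftrightarrow> (\<exists>r. \<forall>n. f n = reval r [n])"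

definition many_one_reducible :: "nat set \<Rightarrow> nat set \<Rightarrow> bool" (infix \<open>\<le>\<^sub>m\<close> 50) where
  "X \<le>\<^sub>m Y \<longleftrightarrow>
     (\<exists>f. partial_recursive f \<and> (\<forall>n. \<exists>m. f n = Some m \<and> (n \<in> X \<longleftrightarrow> m \<in> Y)))"

section \<open>The analytical hierarchy\<close>

text \<open>Formulas of second-order arithmetic, interpreted in the standard model: number variables
  range over \<^typ>\<open>nat\<close> and set variables over all of \<^typ>\<open>nat set\<close>.\<close>

datatype aterm = NVar nat | AZero | ASucc aterm | APlus aterm aterm | ATimes aterm aterm

datatype fm =
    Equal aterm aterm
  | Less aterm aterm
  | Mem aterm nat
  | Neg fm
  | Conj fm fm
  | Disj fm fm
  | ExN nat fm
  | AllN nat fm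
  | ExS nat fm
  | AllS nat fm

fun aeval :: "(nat \<Rightarrow> nat) \<Rightarrow> aterm \<Rightarrow> nat" where
  "aeval e (NVar x) = e x"
| "aeval e AZero = 0"
| "aeval e (ASucc a) = Suc (aeval e a)"
| "aeval e (APlus a b) = aeval e a + aeval e b"
| "aeval e (ATimes a b) = aeval e a * aeval e b"

fun sat :: "(nat \<Rightarrow> nat) \<Rightarrow> (nat \<Rightarrow> nat set) \<Rightarrow> fm \<Rightarrow> bool" where
  "sat e V (Equal a b) \<longleftrightarrow> aeval e a = aeval e b"
| "sat e V (Less a b) \<longleftrightarrow> aeval e a < aeval e b"
| "sat e V (Mem a X) \<longleftrightarrow> aeval e a \<in> V X"
| "sat e V (Neg \<phi>) \<longleftrightarrow> \<not> sat e V \<phi>"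
| "sat e V (Conj \<phi> \<psi>) \<longleftrightarrow> sat e V \<phi> \<and> sat e V \<psi>"
| "sat e V (Disj \<phi> \<psi>) \<longleftrightarrow> sat e V \<phi> \<or> sat e V \<psi>"
| "sat e V (ExN x \<phi>) \<longleftrightarrow> (\<exists>n. sat (e(x := n)) V \<phi>)"
| "sat e V (AllN x \<phi>) \<longleftrightarrow> (\<forall>n. sat (e(x := n)) V \<phi>)"
| "sat e V (ExS X \<phi>) \<longleftrightarrow> (\<exists>A. sat e (V(X := A)) \<phi>)"
| "sat e V (AllS X \<phi>) \<longleftrightarrow> (\<forall>A. sat e (V(X := A)) \<phi>)"

fun avars :: "aterm \<Rightarrow> nat set" where
  "avars (NVar x) = {x}"
| "avars AZero = {}"
| "avars (ASucc a) = avars a"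
| "avars (APlus a b) = avars a \<union> avars b"
| "avars (ATimes a b) = avars a \<union> avars b"

fun free_num :: "fm \<Rightarrow> nat set" where
  "free_num (Equal a b) = avars a \<union> avars b"
| "free_num (Less a b) = avars a \<union> avars b"
| "free_num (Mem a X) = avars a"
| "free_num (Neg \<phi>) = free_num \<phi>"
| "free_num (Conj \<phi> \<psi>) = free_num \<phi> \<union> free_num \<psi>"
| "free_num (Disj \<phi> \<psi>) = free_num \<phi> \<union> free_num \<psi>"
| "free_num (ExN x \<phi>) = free_num \<phi> - {x}"
| "free_num (AllN x \<phi>) = free_num \<phi> - {x}"
| "free_num (ExS X \<phi>) = free_num \<phi>"
| "free_num (AllS X \<phi>) = free_num \<phi>"

fun free_set :: "fm \<Rightarrow> nat set" where
  "free_set (Equal a b) = {}"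
| "free_set (Less a b) = {}"
| "free_set (Mem a X) = {X}"
| "free_set (Neg \<phi>) = free_set \<phi>"
| "free_set (Conj \<phi> \<psi>) = free_set \<phi> \<union> free_set \<psi>"
| "free_set (Disj \<phi> \<psi>) = free_set \<phi> \<union> free_set \<psi>"
| "free_set (ExN x \<phi>) = free_set \<phi>"
| "free_set (AllN x \<phi>) = free_set \<phi>"
| "free_set (ExS X \<phi>) = free_set \<phi> - {X}"
| "free_set (AllS X \<phi>) = free_set \<phi> - {X}"

fun arithmetical :: "fm \<Rightarrow> bool" where
  "arithmetical (Neg \<phi>) \<longleftrightarrow> arithmetical \<phi>"
| "arithmetical (Conj \<phi> \<psi>) \<longleftrightarrow> arithmetical \<phi> \<and> arithmetical \<psi>"
| "arithmetical (Disj \<phi> \<psi>) \<longleftrightarrow> arithmetical \<phi> \<and> arithmetical \<psi>"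
| "arithmetical (ExN x \<phi>) \<longleftrightarrow> arithmetical \<phi>"
| "arithmetical (AllN x \<phi>) \<longleftrightarrow> arithmetical \<phi>"
| "arithmetical (ExS X \<phi>) \<longleftrightarrow> False"
| "arithmetical (AllS X \<phi>) \<longleftrightarrow> False"
| "arithmetical _ \<longleftrightarrow> True"

text \<open>A \<open>\<Sigma>\<^sup>1\<^sub>n\<^sub>+\<^sub>1\<close> formula is a (possibly empty) block of existential set quantifiers in front of a
  \<open>\<Pi>\<^sup>1\<^sub>n\<close> formula, and dually.\<close>

inductive sigma_fm :: "nat \<Rightarrow> fm \<Rightarrow> bool" and pi_fm :: "nat \<Rightarrow> fm \<Rightarrow> bool" where
  "arithmetical \<phi> \<Longrightarrow> sigma_fm 0 \<phi>"
| "arithmetical \<phi> \<Longrightarrow> pi_fm 0 \<phi>"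
| "pi_fm n \<phi> \<Longrightarrow> sigma_fm (Suc n) \<phi>"
| "sigma_fm (Suc n) \<phi> \<Longrightarrow> sigma_fm (Suc n) (ExS X \<phi>)"
| "sigma_fm n \<phi> \<Longrightarrow> pi_fm (Suc n) \<phi>"
| "pi_fm (Suc n) \<phi> \<Longrightarrow> pi_fm (Suc n) (AllS X \<phi>)"

text \<open>The only free variable of \<open>\<phi>\<close> is the number variable \<open>0\<close>, so the other values of the two
  environments do not matter.\<close>

definition defines_set :: "fm \<Rightarrow> nat set \<Rightarrow> bool" where
  "defines_set \<phi> X \<longleftrightarrow>
     free_num \<phi> \<subseteq> {0} \<and> free_set \<phi> = {} \<and> X = {n. sat (\<lambda>_. n) (\<lambda>_. {}) \<phi>}"

definition Sigma1 :: "nat \<Rightarrow> nat set set" where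
  "Sigma1 n = {X. \<exists>\<phi>. sigma_fm n \<phi> \<and> defines_set \<phi> X}"

definition Pi1 :: "nat \<Rightarrow> nat set set" where
  "Pi1 n = {X. \<exists>\<phi>. pi_fm n \<phi> \<and> defines_set \<phi> X}"

end

theory Submission
  imports Defs "HOL-Library.Extended_Nat" "HOL-Library.Countable"
begin

text \<open>In a full algebra the equations are universally quantified over all streams, while the
  function symbols act as existentially quantified functions on streams. Arithmetic on unary
  streams, the order and membership are pinned down by equations. Quantifiers over numbers and sets
  become quantifiers over streams, which are eliminated by Skolem functions \<open>w\<close> subject to the
  critical equation \<open>\<phi>(x) \<rightarrow> \<phi>(w) = 1\<close>. Hence a second-order formula \<open>\<phi>(n)\<close> compiles to a ground
  bit term that evaluates to the truth value of \<open>\<phi>(n)\<close> in every full model, and such models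
  exist by the axiom of choice. With a single specification for both sides, the two solution sets
  of \<open>\<phi>(n) : 000\<dots>\<close> and \<open>1 : 000\<dots>\<close> agree exactly if \<open>\<phi>(n)\<close> is true. Only one equation, defining
  a constant as the numeral \<open>n\<close>, depends on the input, so the reduction is recursive.\<close>

section \<open>Recursive functions\<close>

definition computes1 :: "recf \<Rightarrow> (nat \<Rightarrow> nat) \<Rightarrow> bool" where
  "computes1 r f \<longleftrightarrow> (\<forall>x. reval r [x] = Some (f x))"

definition computes2 :: "recf \<Rightarrow> (nat \<Rightarrow> nat \<Rightarrow> nat) \<Rightarrow> bool" where
  "computes2 r f \<longleftrightarrow> (\<forall>x y. reval r [x, y] = Some (f x y))"

definition recursive1 :: "(nat \<Rightarrow> nat) \<Rightarrow> bool" where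
  "recursive1 f \<longleftrightarrow> (\<exists>r. computes1 r f)"

lemma recursive1I: "computes1 r f \<Longrightarrow> recursive1 f"
  unfolding recursive1_def by blast

lemma computes1_const: "\<exists>r. computes1 r (\<lambda>_. c)"
proof (induction c)
  case 0
  have "computes1 RZero (\<lambda>_. 0)" by (simp add: computes1_def)
  then show ?case by blast
next
  case (Suc c)
  then obtain r where "computes1 r (\<lambda>_. c)" by blast
  then have "computes1 (RComp RSucc [r]) (\<lambda>_. Suc c)" by (simp add: computes1_def)
  then show ?case by blast
qed

lemma recursive1_const [intro, simp]: "recursive1 (\<lambda>_. c)"
  using computes1_const recursive1I by blast

lemma recursive1_Suc:
  assumes "recursive1 f"
  shows "recursive1 (\<lambda>x. Suc (f x))"
proof -
  obtain r where "computes1 r f" using assms unfolding recursive1_def by blast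
  then have "computes1 (RComp RSucc [r]) (\<lambda>x. Suc (f x))" by (simp add: computes1_def)
  then show ?thesis by (rule recursive1I)
qed

lemma recursive1_comp2:
  assumes "computes2 r h" "recursive1 f" "recursive1 g"
  shows "recursive1 (\<lambda>x. h (f x) (g x))"
proof -
  obtain p q where "computes1 p f" "computes1 q g"
    using assms unfolding recursive1_def by blast
  then have "computes1 (RComp r [p, q]) (\<lambda>x. h (f x) (g x))"
    using assms(1) by (simp add: computes1_def computes2_def)
  then show ?thesis by (rule recursive1I)
qed

lemma recursive1_iterate:
  assumes "recursive1 f"
  shows "recursive1 (\<lambda>n. (f ^^ n) c)"
proof -
  obtain p where p: "computes1 p f" using assms unfolding recursive1_def by blast
  obtain q where q: "computes1 q (\<lambda>_. c)" using computes1_const by blast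
  \<comment> \<open>The input is duplicated because \<open>RPrim\<close> hands the arguments after
    the first to its base case, and \<open>q\<close> is known only on one-element lists.\<close>
  let ?r = "RComp (RPrim q (RComp p [RProj 1])) [RProj 0, RProj 0]"
  have "rec_nat (Some c) (\<lambda>k r. Option.bind r (\<lambda>v. Some (f v))) n = Some ((f ^^ n) c)" for n
    by (induction n) auto
  then have "computes1 ?r (\<lambda>n. (f ^^ n) c)"
    using p q by (simp add: computes1_def)
  then show ?thesis by (rule recursive1I)
qed

definition add_recf :: recf where
  "add_recf = RPrim (RProj 0) (RComp RSucc [RProj (Suc 0)])"

lemma reval_add_recf: "reval add_recf (x # y # zs) = Some (x + y)"
proof -
  have "rec_nat (Some y) (\<lambda>k r. Option.bind r (\<lambda>v. Some (Suc v))) x = Some (x + y)"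
    by (induction x) auto
  then show ?thesis by (simp add: add_recf_def)
qed

lemma recursive1_plus:
  "recursive1 f \<Longrightarrow> recursive1 g \<Longrightarrow> recursive1 (\<lambda>x. f x + g x)"
  by (rule recursive1_comp2[of add_recf]) (simp_all add: computes2_def reval_add_recf)

text \<open>The pairing is a triangular number plus the first component, and triangular numbers
  arise by primitive recursion, adding \<open>Suc k\<close> at stage \<open>k\<close>.\<close>

lemma ex_computes2_prod_encode: "\<exists>r. computes2 r (\<lambda>x y. prod_encode (x, y))"
proof -
  let ?tri = "RPrim RZero (RComp add_recf [RComp RSucc [RProj 0], RProj (Suc 0)])"
  have "rec_nat (Some 0) (\<lambda>k r. Option.bind r (\<lambda>v. Some (Suc (k + v)))) n = Some (triangle n)" for n
    by (induction n) (auto simp: algebra_simps)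
  then have tri: "reval ?tri (n # zs) = Some (triangle n)" for n zs
    by (simp add: reval_add_recf)
  have "computes2 (RComp add_recf [RComp ?tri [add_recf], RProj 0]) (\<lambda>x y. prod_encode (x, y))"
    unfolding computes2_def
    by (simp del: reval.simps(5) add: reval_add_recf tri prod_encode_def)
  then show ?thesis by blast
qed

lemma recursive1_prod_encode:
  assumes "recursive1 f" "recursive1 g"
  shows "recursive1 (\<lambda>x. prod_encode (f x, g x))"
  using ex_computes2_prod_encode recursive1_comp2[OF _ assms] by blast

lemma recursive1_id: "recursive1 (\<lambda>x. x)"
  by (rule recursive1I[of "RProj 0"]) (simp add: computes1_def)

lemma partial_recursive_Some:
  assumes "recursive1 f"
  shows "partial_recursive (\<lambda>n. Some (f n))"
  using assms unfolding recursive1_def computes1_def partial_recursive_def by metis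

section \<open>Streams as extended natural numbers\<close>

lemma stream_eq_snthI:
  assumes "\<And>n. \<sigma> !! n = \<tau> !! n"
  shows "\<sigma> = \<tau>"
proof -
  have "snth \<sigma> = snth \<tau>" using assms by auto
  then show ?thesis using stream_smap_nats[of \<sigma>] stream_smap_nats[of \<tau>] by argo
qed

text \<open>A guarded equation has only one solution. Hence one equation each fixes the streams of
  zeros and of ones in every model.\<close>

lemma eq_sconstI:
  assumes "\<sigma> = x ## \<sigma>"
  shows "\<sigma> = sconst x"
proof (rule stream_eq_snthI)
  have "\<sigma> !! n = x" for n
  proof (induction n)
    case 0
    show ?case by (subst assms) simp
  next
    case (Suc n)
    then show ?case by (subst assms) simp
  qed
  then show "\<sigma> !! n = sconst x !! n" for n by simp
qed

lemma sconst_unfold: "sconst x = x ## sconst x"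
  by (subst siterate.code) simp

text \<open>The number of leading ones. What follows the first zero is ignored, so a natural number
  has many representing streams.\<close>

definition cnt :: "bool stream \<Rightarrow> enat" where
  "cnt \<sigma> = (if \<forall>n. \<sigma> !! n then \<infinity> else enat (LEAST n. \<not> \<sigma> !! n))"

lemma cnt_False [simp]: "cnt (False ## \<sigma>) = 0"
proof -
  have "\<not> (\<forall>n. (False ## \<sigma>) !! n)" by (auto intro: exI[of _ 0])
  moreover have "(LEAST n. \<not> (False ## \<sigma>) !! n) = 0" by (rule Least_equality) auto
  ultimately show ?thesis unfolding cnt_def by (simp add: zero_enat_def)
qed

lemma cnt_True [simp]: "cnt (True ## \<sigma>) = eSuc (cnt \<sigma>)"
proof (cases "\<forall>n. \<sigma> !! n")
  case True
  then have "(True ## \<sigma>) !! n" for n by (cases n) auto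
  with True show ?thesis by (simp add: cnt_def)
next
  case False
  then obtain k where k: "\<not> (True ## \<sigma>) !! Suc k" by auto
  then have "(LEAST n. \<not> (True ## \<sigma>) !! n) = Suc (LEAST n. \<not> (True ## \<sigma>) !! Suc n)"
    by (rule Least_Suc) simp
  moreover have "\<not> (\<forall>n. (True ## \<sigma>) !! n)" using k by blast
  ultimately show ?thesis using False by (simp add: cnt_def eSuc_enat)
qed

lemma cnt_infinity: "cnt \<sigma> = \<infinity> \<longleftrightarrow> \<sigma> = sconst True"
  by (auto simp: cnt_def intro: stream_eq_snthI)

lemma cnt_sconst [simp]: "cnt (sconst True) = \<infinity>" "cnt (sconst False) = 0"
  using cnt_False[of "sconst False"] by (simp_all add: cnt_infinity flip: sconst_unfold)

lemma cnt_eq_0E: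
  assumes "cnt \<sigma> = enat 0"
  obtains \<sigma>' where "\<sigma> = False ## \<sigma>'"
proof (cases \<sigma>)
  case (SCons x \<sigma>')
  with assms that show ?thesis by (cases x) (auto simp: enat_0)
qed

lemma cnt_eq_SucE:
  assumes "cnt \<sigma> = enat (Suc k)"
  obtains \<sigma>' where "\<sigma> = True ## \<sigma>'" "cnt \<sigma>' = enat k"
proof (cases \<sigma>)
  case (SCons x \<sigma>')
  with assms that show ?thesis by (cases x) (auto simp: zero_enat_def eSuc_enat_iff)
qed

text \<open>Canonical representatives: addition and multiplication return them on finite
  arguments.\<close>

fun unary :: "enat \<Rightarrow> bool stream" where
  "unary (enat n) = replicate n True @- sconst False"
| "unary \<infinity> = sconst True"

lemma unary_0 [simp]: "unary 0 = sconst False"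
  by (simp add: zero_enat_def)

lemma unary_eSuc [simp]: "unary (eSuc k) = True ## unary k"
  by (cases k) (simp_all add: eSuc_enat flip: sconst_unfold)

lemma cnt_unary [simp]: "cnt (unary k) = k"
proof (cases k)
  case (enat n)
  have "cnt (unary (enat n)) = enat n"
    by (induction n) (simp_all add: zero_enat_def flip: eSuc_enat)
  with enat show ?thesis by simp
qed simp

text \<open>A constant value at infinity is compatible with the membership equations, since removing
  a one leaves infinity unchanged.\<close>

fun lookup :: "enat \<Rightarrow> bool stream \<Rightarrow> bool" where
  "lookup (enat n) \<tau> = \<tau> !! n"
| "lookup \<infinity> \<tau> = False"

lemma lookup_Stream [simp]:
  "lookup 0 (x ## \<tau>) = x" "lookup (eSuc k) (x ## \<tau>) = lookup k \<tau>"
  by (simp_all add: zero_enat_def) (cases k; simp add: eSuc_enat)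

section \<open>Forms and their Skolemization\<close>

instance bsort :: countable by countable_datatype
instance fsym :: countable by countable_datatype
instance bterm :: countable by countable_datatype

text \<open>Implication and falsity generate the connectives, and negated existentials give the
  universal quantifiers, so Skolemization has only three cases.\<close>

datatype form = Atom bterm | Imp form form | Ex nat form

instance form :: countable by countable_datatype

definition upd :: "(bsort \<Rightarrow> nat \<Rightarrow> val) \<Rightarrow> nat \<Rightarrow> val \<Rightarrow> bsort \<Rightarrow> nat \<Rightarrow> val" where
  "upd \<rho> i v = \<rho>(Str := (\<rho> Str)(i := v))"

lemma upd_simps [simp]:
  "upd \<rho> i v Str j = (if j = i then v else \<rho> Str j)" "upd \<rho> i v Bit = \<rho> Bit"
  by (simp_all add: upd_def)

lemma upd_upd [simp]: "upd (upd \<rho> i v) i w = upd \<rho> i w"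
  by (simp add: upd_def)

fun sem :: "stream_alg \<Rightarrow> (bsort \<Rightarrow> nat \<Rightarrow> val) \<Rightarrow> form \<Rightarrow> bool" where
  "sem A \<rho> (Atom b) \<longleftrightarrow> teval A \<rho> b = BitV True"
| "sem A \<rho> (Imp p q) \<longleftrightarrow> (sem A \<rho> p \<longrightarrow> sem A \<rho> q)"
| "sem A \<rho> (Ex i p) \<longleftrightarrow> (\<exists>\<sigma>. sem A (upd \<rho> i (StrV \<sigma>)) p)"

fun sub :: "(nat \<Rightarrow> bterm) \<Rightarrow> bterm \<Rightarrow> bterm" where
  "sub \<theta> (Var Bit x) = Var Bit x"
| "sub \<theta> (Var Str x) = \<theta> x"
| "sub \<theta> (App f ts) = App f (map (sub \<theta>) ts)"

lemma teval_sub: "teval A \<rho> (sub \<theta> t) = teval A (\<rho>(Str := \<lambda>i. teval A \<rho> (\<theta> i))) t"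
  by (induction \<theta> t rule: sub.induct) (auto intro!: arg_cong[where f = "interp A _"])

lemma teval_cong:
  "(\<And>s x. (s, x) \<in> tvars t \<Longrightarrow> \<rho> s x = \<rho>' s x) \<Longrightarrow> teval A \<rho> t = teval A \<rho>' t"
proof (induction t)
  case (App f ts)
  have "teval A \<rho> t = teval A \<rho>' t" if "t \<in> set ts" for t
    using App.IH[OF that] App.prems that by auto
  then have "map (teval A \<rho>) ts = map (teval A \<rho>') ts" by simp
  then show ?case by (simp only: teval.simps)
qed simp

lemma tvars_sub: "tvars (sub \<theta> t) \<subseteq> {Bit} \<times> {x. (Bit, x) \<in> tvars t} \<union> (\<Union>i. tvars (\<theta> i))"
proof (induction \<theta> t rule: sub.induct)
  case (3 \<theta> f ts)
  have "tvars (sub \<theta> t) \<subseteq> {Bit} \<times> {x. (Bit, x) \<in> tvars (App f ts)} \<union> (\<Union>i. tvars (\<theta> i))"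
    if "t \<in> set ts" for t
    using 3[OF that] that by auto
  then show ?case by (simp only: sub.simps tvars.simps set_map) blast
qed auto

lemma finite_tvars: "finite (tvars t)"
  by (induction t) auto

lemma has_sort_Var [simp]: "has_sort \<Sigma> (Var s x) s' \<longleftrightarrow> s' = s"
  by (subst has_sort.simps) auto

lemma has_sort_App [simp]:
  "has_sort \<Sigma> (App f ts) s \<longleftrightarrow> (\<exists>ss. \<Sigma> f = Some (ss, s) \<and> list_all2 (has_sort \<Sigma>) ts ss)"
  by (subst has_sort.simps) auto

lemma has_sort_sub:
  assumes "has_sort \<Sigma> t s" "\<And>i. has_sort \<Sigma> (\<theta> i) Str"
  shows "has_sort \<Sigma> (sub \<theta> t) s"
  using assms(1)
proof (induction rule: has_sort.induct)
  case (Var s x)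
  then show ?case using assms(2) by (cases s) auto
next
  case (App f ss s ts)
  then show ?case by (auto simp: list_all2_conv_all_nth)
qed

lemma has_sort_mono:
  assumes "has_sort \<Sigma> t s" "\<Sigma> \<subseteq>\<^sub>m \<Sigma>'"
  shows "has_sort \<Sigma>' t s"
  using assms(1)
proof (induction rule: has_sort.induct)
  case (App f ss s ts)
  then show ?case using assms(2) by (auto simp: list_all2_conv_all_nth map_le_def dom_def)
qed simp

lemma teval_agree:
  assumes "has_sort \<Sigma> t s" "\<And>f vs. f \<in> dom \<Sigma> \<Longrightarrow> interp A f vs = interp B f vs"
  shows "teval A \<rho> t = teval B \<rho> t"
  using assms(1)
proof (induction rule: has_sort.induct)
  case (App f ss s ts)
  then have "map (teval A \<rho>) ts = map (teval B \<rho>) ts"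
    by (auto simp: list_all2_conv_all_nth list_eq_iff_nth_eq)
  with App.hyps assms(2) show ?case by (auto simp: dom_def simp del: map_eq_conv)
qed simp

text \<open>Nothing is removed at a quantifier: a variable bound outside is free in the inner forms,
  whose witnesses may depend on it.\<close>

fun svars :: "form \<Rightarrow> nat set" where
  "svars (Atom b) = snd ` tvars b"
| "svars (Imp p q) = svars p \<union> svars q"
| "svars (Ex i p) = insert i (svars p)"

lemma finite_svars: "finite (svars p)"
  by (induction p) (auto simp: finite_tvars)

text \<open>Over the base signature this keeps witness symbols out of forms, so that witnesses can
  be chosen by the truth of forms without circularity.\<close>

fun wf_form :: "signat \<Rightarrow> form \<Rightarrow> bool" where
  "wf_form \<Sigma> (Atom b) \<longleftrightarrow> has_sort \<Sigma> b Bit \<and> tvars b \<subseteq> {Str} \<times> UNIV"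
| "wf_form \<Sigma> (Imp p q) \<longleftrightarrow> wf_form \<Sigma> p \<and> wf_form \<Sigma> q"
| "wf_form \<Sigma> (Ex i p) \<longleftrightarrow> wf_form \<Sigma> p"

lemma sem_cong:
  assumes "wf_form \<Sigma> p" "\<And>i. i \<in> svars p \<Longrightarrow> \<rho> Str i = \<rho>' Str i"
  shows "sem A \<rho> p = sem A \<rho>' p"
  using assms
proof (induction p arbitrary: \<rho> \<rho>')
  case (Atom b)
  have "teval A \<rho> b = teval A \<rho>' b"
  proof (rule teval_cong)
    fix s x assume "(s, x) \<in> tvars b"
    then have "x \<in> svars (Atom b)" by force
    then show "\<rho> s x = \<rho>' s x" using Atom.prems \<open>(s, x) \<in> tvars b\<close> by auto
  qed
  then show ?case by simp
next
  case (Imp p q)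
  have "sem A \<rho> p = sem A \<rho>' p" using Imp.prems by (intro Imp.IH(1)) simp_all
  moreover have "sem A \<rho> q = sem A \<rho>' q" using Imp.prems by (intro Imp.IH(2)) simp_all
  ultimately show ?case by simp
next
  case (Ex i p)
  have "sem A (upd \<rho> i v) p = sem A (upd \<rho>' i v) p" for v
    using Ex.prems by (intro Ex.IH) auto
  then show ?case by simp
qed

lemma sem_agree:
  assumes "wf_form \<Sigma> p" "\<And>f vs. f \<in> dom \<Sigma> \<Longrightarrow> interp A f vs = interp B f vs"
  shows "sem A \<rho> p = sem B \<rho> p"
  using assms(1)
proof (induction p arbitrary: \<rho>)
  case (Atom b)
  then have "has_sort \<Sigma> b Bit" by simp
  then have "teval A \<rho> b = teval B \<rho> b" using assms(2) by (rule teval_agree)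
  then show ?case by simp
qed auto

section \<open>Symbols and equations of the specifications\<close>

abbreviation "zero_t \<equiv> App Bit0 []"
abbreviation "one_t \<equiv> App Bit1 []"
abbreviation "scon_t x \<sigma> \<equiv> App SCon [x, \<sigma>]"
abbreviation "ite_t b x y \<equiv> App (Fn 0) [b, x, y]"
abbreviation "zeros_t \<equiv> App (Fn 1) []"
abbreviation "ones_t \<equiv> App (Fn 2) []"
abbreviation "less_t \<sigma> \<tau> \<equiv> App (Fn 3) [\<sigma>, \<tau>]"
abbreviation "mem_t \<sigma> \<tau> \<equiv> App (Fn 4) [\<sigma>, \<tau>]"
abbreviation "plus_t \<sigma> \<tau> \<equiv> App (Fn 5) [\<sigma>, \<tau>]"
abbreviation "times_t \<sigma> \<tau> \<equiv> App (Fn 6) [\<sigma>, \<tau>]"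
abbreviation "input_t \<equiv> App (Fn 7) []"

text \<open>The offset avoids the base symbols \<open>Fn 0\<close> to \<open>Fn 7\<close>; coding
  the pair gives each existential form its own symbol.\<close>

definition wit :: "nat \<Rightarrow> form \<Rightarrow> fsym" where
  "wit i p = Fn (8 + to_nat (i, p))"

definition wit_args :: "nat \<Rightarrow> nat \<Rightarrow> bterm list" where
  "wit_args N i = map (\<lambda>j. if j = i then zeros_t else Var Str j) [0..<N]"

text \<open>Epsilon terms: an existential form is its body with a witness substituted. The slot of
  the bound variable is filled by a constant, so that the witness does not depend on it.\<close>

fun skolem :: "nat \<Rightarrow> form \<Rightarrow> bterm" where
  "skolem N (Atom b) = b"
| "skolem N (Imp p q) = ite_t (skolem N p) (skolem N q) one_t"
| "skolem N (Ex i p) = sub ((Var Str)(i := App (wit i p) (wit_args N i))) (skolem N p)"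

fun exs :: "form \<Rightarrow> (nat \<times> form) list" where
  "exs (Atom b) = []"
| "exs (Imp p q) = exs p @ exs q"
| "exs (Ex i p) = (i, p) # exs p"

text \<open>\<open>Var Str i\<close> stays free in the first \<open>skolem N p\<close>, so as a
  variable of the equation it ranges over all candidate solutions of the body.\<close>

fun wit_eqn :: "nat \<Rightarrow> nat \<times> form \<Rightarrow> bterm \<times> bterm" where
  "wit_eqn N (i, p) = (ite_t (skolem N p) (skolem N (Ex i p)) one_t, one_t)"

fun wit_decl :: "nat \<Rightarrow> nat \<times> form \<Rightarrow> fsym \<times> ftype" where
  "wit_decl N (i, p) = (wit i p, (replicate N Str, Str))"

definition base_decls :: "(fsym \<times> ftype) list" where
  "base_decls =
     [(Bit0, ([], Bit)), (Bit1, ([], Bit)), (SCon, ([Bit, Str], Str)),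
      (Fn 0, ([Bit, Bit, Bit], Bit)), (Fn 1, ([], Str)), (Fn 2, ([], Str)),
      (Fn 3, ([Str, Str], Bit)), (Fn 4, ([Str, Str], Bit)),
      (Fn 5, ([Str, Str], Str)), (Fn 6, ([Str, Str], Str)), (Fn 7, ([], Str))]"

definition decls :: "nat \<Rightarrow> form \<Rightarrow> (fsym \<times> ftype) list" where
  "decls N p = base_decls @ map (wit_decl N) (exs p)"

text \<open>The numeral \<open>k\<close> is represented by every stream that starts with exactly \<open>k\<close> ones; the
  constant stream of ones behaves as infinity, so that being less than it expresses finiteness.\<close>

definition base_eqns :: "(bterm \<times> bterm) list" where
  "base_eqns = (let x = Var Bit 0; y = Var Bit 1; \<sigma> = Var Str 0; \<tau> = Var Str 1 in
     [(ite_t one_t x y, x), (ite_t zero_t x y, y),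
      (zeros_t, scon_t zero_t zeros_t), (ones_t, scon_t one_t ones_t),
      (less_t \<sigma> (scon_t zero_t \<tau>), zero_t),
      (less_t (scon_t zero_t \<sigma>) (scon_t one_t \<tau>), one_t),
      (less_t (scon_t one_t \<sigma>) (scon_t one_t \<tau>), less_t \<sigma> \<tau>),
      (less_t ones_t ones_t, zero_t),
      (mem_t (scon_t zero_t \<sigma>) (scon_t x \<tau>), x),
      (mem_t (scon_t one_t \<sigma>) (scon_t x \<tau>), mem_t \<sigma> \<tau>),
      (plus_t (scon_t zero_t \<sigma>) (scon_t zero_t \<tau>), zeros_t),
      (plus_t (scon_t zero_t \<sigma>) (scon_t one_t \<tau>), scon_t one_t (plus_t (scon_t zero_t \<sigma>) \<tau>)),
      (plus_t (scon_t one_t \<sigma>) \<tau>, scon_t one_t (plus_t \<sigma> \<tau>)),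
      (times_t (scon_t zero_t \<sigma>) \<tau>, zeros_t),
      (times_t (scon_t one_t \<sigma>) \<tau>, plus_t \<tau> (times_t \<sigma> \<tau>))])"

fun numeral_t :: "nat \<Rightarrow> bterm" where
  "numeral_t 0 = zeros_t"
| "numeral_t (Suc n) = scon_t one_t (numeral_t n)"

definition eqns :: "nat \<Rightarrow> form \<Rightarrow> nat \<Rightarrow> (bterm \<times> bterm) list" where
  "eqns N p n = (input_t, numeral_t n) # base_eqns @ map (wit_eqn N) (exs p)"

section \<open>Truth in an arbitrary model\<close>

fun aterm_t :: "aterm \<Rightarrow> bterm" where
  "aterm_t (NVar x) = Var Str (2 * x)"
| "aterm_t AZero = zeros_t"
| "aterm_t (ASucc a) = scon_t one_t (aterm_t a)"
| "aterm_t (APlus a b) = plus_t (aterm_t a) (aterm_t b)"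
| "aterm_t (ATimes a b) = times_t (aterm_t a) (aterm_t b)"

abbreviation "neg_form p \<equiv> Imp p (Atom zero_t)"
abbreviation "conj_form p q \<equiv> neg_form (Imp p (neg_form q))"
abbreviation "finite_form x \<equiv> Atom (less_t (Var Str (2 * x)) ones_t)"

text \<open>Number variables become even and set variables odd stream variables.\<close>

fun conv :: "fm \<Rightarrow> form" where
  "conv (Equal a b) =
     conj_form (neg_form (Atom (less_t (aterm_t a) (aterm_t b))))
       (neg_form (Atom (less_t (aterm_t b) (aterm_t a))))"
| "conv (Less a b) = Atom (less_t (aterm_t a) (aterm_t b))"
| "conv (Mem a X) = Atom (mem_t (aterm_t a) (Var Str (Suc (2 * X))))"
| "conv (Neg \<phi>) = neg_form (conv \<phi>)"
| "conv (Conj \<phi> \<psi>) = conj_form (conv \<phi>) (conv \<psi>)"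
| "conv (Disj \<phi> \<psi>) = Imp (neg_form (conv \<phi>)) (conv \<psi>)"
| "conv (ExN x \<phi>) = Ex (2 * x) (conj_form (finite_form x) (conv \<phi>))"
| "conv (AllN x \<phi>) = neg_form (Ex (2 * x) (neg_form (Imp (finite_form x) (conv \<phi>))))"
| "conv (ExS X \<phi>) = Ex (Suc (2 * X)) (conv \<phi>)"
| "conv (AllS X \<phi>) = neg_form (Ex (Suc (2 * X)) (neg_form (conv \<phi>)))"

abbreviation "base_sig \<equiv> map_of base_decls"

lemma aterm_t_wf: "has_sort base_sig (aterm_t a) Str" "tvars (aterm_t a) \<subseteq> {Str} \<times> UNIV"
  by (induction a) (auto simp: base_decls_def)

lemma wf_conv: "wf_form base_sig (conv \<phi>)"
  using aterm_t_wf by (induction \<phi>) (auto simp: base_decls_def)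

definition represents ::
  "(bsort \<Rightarrow> nat \<Rightarrow> val) \<Rightarrow> (nat \<Rightarrow> nat) \<Rightarrow> (nat \<Rightarrow> nat set) \<Rightarrow> bool" where
  "represents \<rho> e V \<longleftrightarrow>
     (\<forall>x. \<exists>\<sigma>. \<rho> Str (2 * x) = StrV \<sigma> \<and> cnt \<sigma> = enat (e x)) \<and>
     (\<forall>X. \<exists>\<sigma>. \<rho> Str (Suc (2 * X)) = StrV \<sigma> \<and> V X = {n. \<sigma> !! n})"

lemma even_neq_odd: "2 * x \<noteq> Suc (2 * y)" "Suc (2 * y) \<noteq> 2 * x" for x y :: nat
  by presburger+

lemma represents_num:
  "represents \<rho> e V \<Longrightarrow> cnt \<sigma> = enat n \<Longrightarrow> represents (upd \<rho> (2 * x) (StrV \<sigma>)) (e(x := n)) V"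
  by (auto simp: represents_def even_neq_odd)

lemma represents_set:
  "represents \<rho> e V \<Longrightarrow> represents (upd \<rho> (Suc (2 * X)) (StrV \<sigma>)) e (V(X := {n. \<sigma> !! n}))"
  by (auto simp: represents_def even_neq_odd)

lemma ex_cnt: "\<exists>\<sigma>. cnt \<sigma> = enat n"
  using cnt_unary by blast

lemma ex_characteristic: "\<exists>\<sigma>. {n. \<sigma> !! n} = S"
  by (rule exI[of _ "smap (\<lambda>n. n \<in> S) nats"]) simp

text \<open>Covers arbitrary full models and the canonical one alike. The witness equations are left
  out, because for the canonical model they have yet to be derived.\<close>

locale base_model =
  fixes \<Sigma> :: signat and A :: stream_alg
  assumes algebra: "stream_algebra \<Sigma> A"
    and fullness: "full A"
    and base_sig: "base_sig \<subseteq>\<^sub>m \<Sigma>"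
    and base_eqns: "model A (set base_eqns)"
begin

lemma strs_UNIV [simp]: "strs A = UNIV"
  using fullness by (simp add: full_def)

lemma StrV_in_sort_dom [simp]: "StrV \<sigma> \<in> sort_dom A Str"
  by simp

lemma interp_constructors [simp]:
  "interp A Bit0 [] = BitV False" "interp A Bit1 [] = BitV True"
  "interp A SCon [BitV x, StrV \<sigma>] = StrV (x ## \<sigma>)"
  using algebra fullness by (auto simp: stream_algebra_def full_def)

text \<open>The base equations use only the variables \<open>0\<close> and \<open>1\<close> of each
  sort, so these assignments yield all their instances.\<close>

definition asg :: "bool \<Rightarrow> bool \<Rightarrow> bool stream \<Rightarrow> bool stream \<Rightarrow> bsort \<Rightarrow> nat \<Rightarrow> val" where
  "asg x y \<sigma> \<tau> s i = (case s of Bit \<Rightarrow> BitV (if i = 0 then x else y)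
                             | Str \<Rightarrow> StrV (if i = 0 then \<sigma> else \<tau>))"

lemma asg_simps [simp]:
  "asg x y \<sigma> \<tau> Bit i = BitV (if i = 0 then x else y)"
  "asg x y \<sigma> \<tau> Str i = StrV (if i = 0 then \<sigma> else \<tau>)"
  by (simp_all add: asg_def)

lemma assignment_asg: "assignment A (asg x y \<sigma> \<tau>)"
  unfolding assignment_def
proof (intro allI)
  fix s i show "asg x y \<sigma> \<tau> s i \<in> sort_dom A s" by (cases s) auto
qed

lemma eqn_holds:
  "\<forall>e\<in>set base_eqns. teval A (asg x y \<sigma> \<tau>) (fst e) = teval A (asg x y \<sigma> \<tau>) (snd e)"
  using base_eqns assignment_asg unfolding model_def by (auto split: prod.splits)

lemma interp_const:
  assumes "base_sig f = Some ([], Str)"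
  shows "\<exists>\<sigma>. interp A f [] = StrV \<sigma>"
proof -
  have "\<Sigma> f = Some ([], Str)" using assms base_sig by (auto simp: map_le_def dom_def)
  then have "interp A f [] \<in> sort_dom A Str"
    using algebra unfolding stream_algebra_def by blast
  then show ?thesis by auto
qed

lemma interp_zeros [simp]: "interp A (Fn (Suc 0)) [] = StrV (sconst False)"
proof -
  obtain z where z: "interp A (Fn (Suc 0)) [] = StrV z"
    using interp_const[of "Fn 1"] by (auto simp: base_decls_def)
  have "z = False ## z"
    using eqn_holds by (simp add: base_eqns_def Let_def z)
  with z show ?thesis using eq_sconstI by metis
qed

lemma interp_ones [simp]: "interp A (Fn 2) [] = StrV (sconst True)"
proof -
  obtain z where z: "interp A (Fn 2) [] = StrV z"
    using interp_const[of "Fn 2"] by (auto simp: base_decls_def)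
  have "z = True ## z"
    using eqn_holds by (simp add: base_eqns_def Let_def z)
  with z show ?thesis using eq_sconstI by metis
qed

text \<open>The base equations as rewrite rules. Some right sides keep \<open>interp A SCon\<close>,
  since only the later inductions exhibit the inner value as a stream.\<close>

lemma interp_ops [simp]:
  "interp A (Fn 0) [BitV b, BitV x, BitV y] = BitV (if b then x else y)"
  "interp A (Fn 3) [StrV \<sigma>, StrV (False ## \<tau>)] = BitV False"
  "interp A (Fn 3) [StrV (False ## \<sigma>), StrV (True ## \<tau>)] = BitV True"
  "interp A (Fn 3) [StrV (True ## \<sigma>), StrV (True ## \<tau>)] = interp A (Fn 3) [StrV \<sigma>, StrV \<tau>]"
  "interp A (Fn 3) [StrV (sconst True), StrV (sconst True)] = BitV False"
  "interp A (Fn 4) [StrV (False ## \<sigma>), StrV (x ## \<tau>)] = BitV x"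
  "interp A (Fn 4) [StrV (True ## \<sigma>), StrV (x ## \<tau>)] = interp A (Fn 4) [StrV \<sigma>, StrV \<tau>]"
  "interp A (Fn 5) [StrV (False ## \<sigma>), StrV (False ## \<tau>)] = StrV (sconst False)"
  "interp A (Fn 5) [StrV (False ## \<sigma>), StrV (True ## \<tau>)] =
     interp A SCon [BitV True, interp A (Fn 5) [StrV (False ## \<sigma>), StrV \<tau>]]"
  "interp A (Fn 5) [StrV (True ## \<sigma>), StrV \<tau>] =
     interp A SCon [BitV True, interp A (Fn 5) [StrV \<sigma>, StrV \<tau>]]"
  "interp A (Fn 6) [StrV (False ## \<sigma>), StrV \<tau>] = StrV (sconst False)"
  "interp A (Fn 6) [StrV (True ## \<sigma>), StrV \<tau>] =
     interp A (Fn 5) [StrV \<tau>, interp A (Fn 6) [StrV \<sigma>, StrV \<tau>]]"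
  using eqn_holds[of x y \<sigma> \<tau>] by (simp_all add: base_eqns_def Let_def)

lemma interp_less:
  "cnt \<sigma> = enat j \<Longrightarrow> cnt \<tau> = enat k \<Longrightarrow> interp A (Fn 3) [StrV \<sigma>, StrV \<tau>] = BitV (j < k)"
proof (induction j arbitrary: k \<sigma> \<tau>)
  case 0
  then show ?case by (cases k) (auto elim!: cnt_eq_0E cnt_eq_SucE)
next
  case (Suc j)
  then show ?case by (cases k) (auto elim!: cnt_eq_0E cnt_eq_SucE)
qed

lemma interp_less_ones: "interp A (Fn 3) [StrV \<sigma>, StrV (sconst True)] = BitV (cnt \<sigma> \<noteq> \<infinity>)"
proof (cases "cnt \<sigma>")
  case (enat k)
  then have "interp A (Fn 3) [StrV \<sigma>, StrV (sconst True)] = BitV True"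
  proof (induction k arbitrary: \<sigma>)
    case 0
    then show ?case by (subst sconst_unfold) (auto elim!: cnt_eq_0E)
  next
    case (Suc k)
    from Suc.prems obtain \<sigma>' where "\<sigma> = True ## \<sigma>'" "cnt \<sigma>' = enat k" by (rule cnt_eq_SucE)
    then show ?case using Suc.IH[of \<sigma>'] interp_ops(4) sconst_unfold by metis
  qed
  with enat show ?thesis by simp
next
  \<comment> \<open>Removing ones never reaches a zero here; the value comes from the separate
    equation for \<open>less_t ones_t ones_t\<close>.\<close>
  case infinity
  then show ?thesis by (simp add: cnt_infinity)
qed

lemma interp_mem: "cnt \<sigma> = enat k \<Longrightarrow> interp A (Fn 4) [StrV \<sigma>, StrV \<tau>] = BitV (\<tau> !! k)"
proof (induction k arbitrary: \<sigma> \<tau>)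
  case 0
  then show ?case by (cases \<tau>) (auto elim!: cnt_eq_0E)
next
  case (Suc k)
  then show ?case by (cases \<tau>) (auto elim!: cnt_eq_SucE)
qed

text \<open>The equation for two zero heads returns \<open>zeros_t\<close> and so discards both
  tails; the result is canonical even if the arguments are not.\<close>

lemma interp_plus:
  "cnt \<sigma> = enat j \<Longrightarrow> cnt \<tau> = enat k \<Longrightarrow>
   interp A (Fn 5) [StrV \<sigma>, StrV \<tau>] = StrV (unary (enat (j + k)))"
proof (induction j arbitrary: \<sigma>)
  case 0
  \<comment> \<open>With a zero head in the first argument the recursion moves to the second, hence
    an inner induction on \<open>k\<close>.\<close>
  from 0(2,1) show ?case
    by (induction k arbitrary: \<tau>) (auto elim!: cnt_eq_0E cnt_eq_SucE)
next
  case (Suc j)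
  then show ?case by (auto elim!: cnt_eq_SucE)
qed

lemma interp_times:
  "cnt \<sigma> = enat j \<Longrightarrow> cnt \<tau> = enat k \<Longrightarrow>
   interp A (Fn 6) [StrV \<sigma>, StrV \<tau>] = StrV (unary (enat (j * k)))"
proof (induction j arbitrary: \<sigma>)
  case 0
  then show ?case by (auto elim!: cnt_eq_0E)
next
  case (Suc j)
  then show ?case by (auto elim!: cnt_eq_SucE simp: interp_plus simp del: unary.simps)
qed

lemma teval_numeral_t: "teval A \<rho> (numeral_t n) = StrV (unary (enat n))"
  by (induction n) simp_all

lemma teval_aterm_t:
  assumes "represents \<rho> e V"
  shows "\<exists>\<sigma>. teval A \<rho> (aterm_t a) = StrV \<sigma> \<and> cnt \<sigma> = enat (aeval e a)"
proof (induction a)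
  case (NVar x)
  then show ?case using assms by (auto simp: represents_def)
next
  case (APlus a b)
  then show ?case by (auto simp: interp_plus simp del: unary.simps)
next
  case (ATimes a b)
  then show ?case by (auto simp: interp_times simp del: unary.simps)
qed (auto simp: zero_enat_def simp flip: eSuc_enat)

lemma sem_finite_form:
  "sem A (upd \<rho> (2 * x) (StrV \<sigma>)) (finite_form x) \<longleftrightarrow> cnt \<sigma> \<noteq> \<infinity>"
  by (simp add: interp_less_ones)

text \<open>Number quantifiers match because every number is represented by some stream and
  \<open>finite_form\<close> excludes infinity; set quantifiers match because streams are exactly
  the characteristic functions of sets.\<close>

lemma sem_conv: "represents \<rho> e V \<Longrightarrow> sem A \<rho> (conv \<phi>) \<longleftrightarrow> sat e V \<phi>"
proof (induction \<phi> arbitrary: \<rho> e V)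
  \<comment> \<open>Equality is coded as incomparability, since distinct streams may represent the
    same number.\<close>
  case (Equal a b)
  then show ?case
    using teval_aterm_t[OF Equal, of a] teval_aterm_t[OF Equal, of b]
    by (auto simp: interp_less)
next
  case (Less a b)
  then show ?case
    using teval_aterm_t[OF Less, of a] teval_aterm_t[OF Less, of b]
    by (auto simp: interp_less)
next
  case (Mem a X)
  obtain \<tau> where "\<rho> Str (Suc (2 * X)) = StrV \<tau>" "V X = {n. \<tau> !! n}"
    using Mem unfolding represents_def by blast
  then show ?case
    using teval_aterm_t[OF Mem, of a] by (auto simp: interp_mem)
next
  case (ExN x \<phi>)
  have "sem A (upd \<rho> (2 * x) (StrV \<sigma>)) (conv \<phi>) \<longleftrightarrow> sat (e(x := n)) V \<phi>"
    if "cnt \<sigma> = enat n" for \<sigma> n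
    using ExN.IH[OF represents_num[OF ExN.prems that]] .
  then have "(\<exists>\<sigma>. cnt \<sigma> \<noteq> \<infinity> \<and> sem A (upd \<rho> (2 * x) (StrV \<sigma>)) (conv \<phi>)) \<longleftrightarrow>
      (\<exists>n. sat (e(x := n)) V \<phi>)"
    using ex_cnt unfolding not_infinity_eq by blast
  then show ?case
    by (simp del: sem.simps(1) not_infinity_eq add: sem_finite_form sem.simps(1)[of _ _ zero_t])
next
  case (AllN x \<phi>)
  have "sem A (upd \<rho> (2 * x) (StrV \<sigma>)) (conv \<phi>) \<longleftrightarrow> sat (e(x := n)) V \<phi>"
    if "cnt \<sigma> = enat n" for \<sigma> n
    using AllN.IH[OF represents_num[OF AllN.prems that]] .
  then have "(\<forall>\<sigma>. cnt \<sigma> \<noteq> \<infinity> \<longrightarrow> sem A (upd \<rho> (2 * x) (StrV \<sigma>)) (conv \<phi>)) \<longleftrightarrow>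
      (\<forall>n. sat (e(x := n)) V \<phi>)"
    using ex_cnt unfolding not_infinity_eq by blast
  then show ?case
    by (simp del: sem.simps(1) not_infinity_eq add: imp_conv_disj sem_finite_form sem.simps(1)[of _ _ zero_t])
next
  case (ExS X \<phi>)
  have "sem A (upd \<rho> (Suc (2 * X)) (StrV \<sigma>)) (conv \<phi>) \<longleftrightarrow> sat e (V(X := {n. \<sigma> !! n})) \<phi>"
    for \<sigma>
    using ExS.IH[OF represents_set[OF ExS.prems]] .
  then have "(\<exists>\<sigma>. sem A (upd \<rho> (Suc (2 * X)) (StrV \<sigma>)) (conv \<phi>)) \<longleftrightarrow>
      (\<exists>S. sat e (V(X := S)) \<phi>)"
    using ex_characteristic by metis
  then show ?case by simp
next
  case (AllS X \<phi>)
  have "sem A (upd \<rho> (Suc (2 * X)) (StrV \<sigma>)) (conv \<phi>) \<longleftrightarrow> sat e (V(X := {n. \<sigma> !! n})) \<phi>"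
    for \<sigma>
    using AllS.IH[OF represents_set[OF AllS.prems]] .
  then have "(\<forall>\<sigma>. sem A (upd \<rho> (Suc (2 * X)) (StrV \<sigma>)) (conv \<phi>)) \<longleftrightarrow>
      (\<forall>S. sat e (V(X := S)) \<phi>)"
    using ex_characteristic by metis
  then show ?case by simp
qed (simp_all, blast)

section \<open>Skolem terms in a full model\<close>

lemma assignment_upd: "assignment A \<rho> \<Longrightarrow> assignment A (upd \<rho> i (StrV \<sigma>))"
  unfolding assignment_def
proof (intro allI)
  fix s x assume "\<forall>s x. \<rho> s x \<in> sort_dom A s"
  then show "upd \<rho> i (StrV \<sigma>) s x \<in> sort_dom A s" by (cases s) (auto simp del: sort_dom.simps)
qed

lemma teval_wit_args:
  "map (teval A \<rho>) (wit_args N i) =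
     map (\<lambda>j. if j = i then StrV (sconst False) else \<rho> Str j) [0..<N]"
  by (simp add: wit_args_def)

lemma teval_Ex:
  "teval A \<rho> (skolem N (Ex i p)) =
     teval A (upd \<rho> i (interp A (wit i p) (map (teval A \<rho>) (wit_args N i)))) (skolem N p)"
proof -
  have "\<rho>(Str := \<lambda>j. teval A \<rho> (((Var Str)(i := App (wit i p) (wit_args N i))) j)) =
      upd \<rho> i (interp A (wit i p) (map (teval A \<rho>) (wit_args N i)))"
    by (simp add: upd_def fun_eq_iff)
  then show ?thesis by (simp only: skolem.simps teval_sub)
qed

lemma teval_atom:
  assumes "wf_form base_sig (Atom b)" "assignment A \<rho>"
  shows "teval A \<rho> b = BitV (sem A \<rho> (Atom b))"
proof -
  have "has_sort \<Sigma> b Bit" using assms(1) base_sig has_sort_mono by auto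
  then have "teval A \<rho> b \<in> sort_dom A Bit" by (rule teval_in_sort_dom[OF algebra assms(2)])
  then show ?thesis by auto
qed

text \<open>At an existential form, truth at the witness gives existence. Conversely, the critical
  equation with the bound variable set to a given solution makes the witness a solution too.\<close>

lemma teval_skolem:
  assumes "wf_form base_sig p"
    and "\<And>i p. (i, p) \<in> set (exs q) \<Longrightarrow> \<Sigma> (wit i p) = Some (replicate N Str, Str)"
    and "model A (wit_eqn N ` set (exs q))"
    and "set (exs p) \<subseteq> set (exs q)"
    and "assignment A \<rho>"
  shows "teval A \<rho> (skolem N p) = BitV (sem A \<rho> p)"
  using assms(1,4,5)
proof (induction p arbitrary: \<rho>)
  case (Atom b)
  then show ?case using teval_atom by simp
next
  case (Imp p q)
  then show ?case by simp
next
  case (Ex i p)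
  let ?w = "\<lambda>\<rho>. interp A (wit i p) (map (teval A \<rho>) (wit_args N i))"
  have IH: "teval A \<rho>' (skolem N p) = BitV (sem A \<rho>' p)" if "assignment A \<rho>'" for \<rho>'
    using Ex that by simp
  have "\<Sigma> (wit i p) = Some (replicate N Str, Str)"
    using assms(2) Ex.prems(2) by simp
  moreover have "list_all2 (\<lambda>v s'. v \<in> sort_dom A s') (map (teval A \<rho>) (wit_args N i)) (replicate N Str)"
    using Ex.prems(3) unfolding teval_wit_args assignment_def
    by (auto simp: list_all2_conv_all_nth simp del: sort_dom.simps)
  ultimately have "?w \<rho> \<in> sort_dom A Str"
    using algebra unfolding stream_algebra_def by blast
  then obtain \<omega> where w: "?w \<rho> = StrV \<omega>" by auto
  have ex: "teval A \<rho> (skolem N (Ex i p)) = BitV (sem A (upd \<rho> i (StrV \<omega>)) p)"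
    unfolding teval_Ex w using IH assignment_upd Ex.prems(3) by blast
  moreover have "sem A (upd \<rho> i (StrV \<omega>)) p" if "sem A (upd \<rho> i (StrV \<sigma>)) p" for \<sigma>
  proof -
    let ?\<rho> = "upd \<rho> i (StrV \<sigma>)"
    have asg: "assignment A ?\<rho>" using assignment_upd Ex.prems(3) by blast
    \<comment> \<open>Slot \<open>i\<close> of \<open>wit_args\<close> holds a constant, so changing
      variable \<open>i\<close> does not move the witness.\<close>
    have "?w ?\<rho> = ?w \<rho>" unfolding teval_wit_args by (auto intro!: arg_cong[where f = "interp A _"])
    then have "teval A ?\<rho> (skolem N (Ex i p)) = teval A \<rho> (skolem N (Ex i p))"
      unfolding teval_Ex by simp
    moreover have "teval A ?\<rho> (ite_t (skolem N p) (skolem N (Ex i p)) one_t) = teval A ?\<rho> one_t"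
      using assms(3) Ex.prems(2) asg unfolding model_def by force
    ultimately show ?thesis
      using that IH[OF asg] ex by (simp del: skolem.simps)
  qed
  ultimately show ?case by auto
qed

end

section \<open>The canonical model\<close>

fun bit_of :: "val \<Rightarrow> bool" where
  "bit_of (BitV b) = b"
| "bit_of (StrV \<sigma>) = undefined"

fun str_of :: "val \<Rightarrow> bool stream" where
  "str_of (StrV \<sigma>) = \<sigma>"
| "str_of (BitV b) = undefined"

text \<open>Counting in the extended naturals makes the recursions hold for all streams, also those
  with infinite count. The last branch serves the input constant \<open>Fn 7\<close> and is a mere
  default beyond it.\<close>

definition base_interp :: "nat \<Rightarrow> fsym \<Rightarrow> val list \<Rightarrow> val" where
  "base_interp n f vs =
     (case f of
        Bit0 \<Rightarrow> BitV False
      | Bit1 \<Rightarrow> BitV True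
      | SCon \<Rightarrow> StrV (bit_of (vs ! 0) ## str_of (vs ! 1))
      | Fn k \<Rightarrow>
          if k = 0 then BitV (if bit_of (vs ! 0) then bit_of (vs ! 1) else bit_of (vs ! 2))
          else if k = 1 then StrV (sconst False)
          else if k = 2 then StrV (sconst True)
          else if k = 3 then BitV (cnt (str_of (vs ! 0)) < cnt (str_of (vs ! 1)))
          else if k = 4 then BitV (lookup (cnt (str_of (vs ! 0))) (str_of (vs ! 1)))
          else if k = 5 then StrV (unary (cnt (str_of (vs ! 0)) + cnt (str_of (vs ! 1))))
          else if k = 6 then StrV (unary (cnt (str_of (vs ! 0)) * cnt (str_of (vs ! 1))))
          else StrV (unary (enat n)))"

definition base_alg :: "nat \<Rightarrow> stream_alg" where
  "base_alg n = \<lparr>strs = UNIV, interp = base_interp n\<rparr>"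

definition env :: "val list \<Rightarrow> bsort \<Rightarrow> nat \<Rightarrow> val" where
  "env vs s j = vs ! j"

text \<open>Truth is taken in \<open>base_alg\<close>, where witness symbols have default values, so
  the choice is not circular.\<close>

definition wit_interp :: "nat \<Rightarrow> nat \<Rightarrow> form \<Rightarrow> val list \<Rightarrow> val" where
  "wit_interp n i p vs = StrV (SOME \<sigma>. sem (base_alg n) (upd (env vs) i (StrV \<sigma>)) p)"

text \<open>All witness symbols are interpreted at once. As \<open>wit\<close> is injective, the
  choice of \<open>(i, p)\<close> recovers the form that the symbol names.\<close>

definition canonical :: "nat \<Rightarrow> stream_alg" where
  "canonical n = \<lparr>strs = UNIV, interp = (\<lambda>f vs.
     if \<exists>i p. f = wit i p then case_prod (wit_interp n) (SOME (i, p). f = wit i p) vs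
     else base_interp n f vs)\<rparr>"

lemma wit_eq_iff [simp]: "wit i p = wit j q \<longleftrightarrow> i = j \<and> p = q"
  by (auto simp: wit_def)

lemma base_decls_not_wit: "f \<in> fst ` set base_decls \<Longrightarrow> f \<noteq> wit i p"
  by (auto simp: base_decls_def wit_def)

lemma dom_base_sig: "dom base_sig = fst ` set base_decls"
  by (rule dom_map_of_conv_image_fst)

lemma interp_canonical:
  "f \<in> fst ` set base_decls \<Longrightarrow> interp (canonical n) f vs = base_interp n f vs"
  "interp (canonical n) (wit i p) vs = wit_interp n i p vs"
  using base_decls_not_wit by (auto simp: canonical_def)

lemma strs_canonical [simp]: "strs (canonical n) = UNIV"
  by (simp add: canonical_def)

lemma full_canonical: "full (canonical n)"
  by (simp add: full_def)

lemma map_of_wit_decls: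
  "(i, p) \<in> set xs \<Longrightarrow> map_of (map (wit_decl N) xs) (wit i p) = Some (replicate N Str, Str)"
proof (induction xs)
  case (Cons x xs)
  obtain j q where "x = (j, q)" by (cases x)
  with Cons show ?case by auto
qed simp

lemma base_sig_decls: "base_sig \<subseteq>\<^sub>m map_of (decls N q)"
  by (simp add: decls_def)

lemma base_sig_wit: "base_sig (wit i p) = None"
  using base_decls_not_wit by (fastforce simp: map_of_eq_None_iff)

lemma decls_wit: "(i, p) \<in> set (exs q) \<Longrightarrow> map_of (decls N q) (wit i p) = Some (replicate N Str, Str)"
  by (simp add: decls_def map_add_def base_sig_wit map_of_wit_decls)

lemma stream_algebra_canonical: "stream_algebra (map_of (decls N q)) (canonical n)"
  unfolding stream_algebra_def
proof (intro conjI allI impI ballI)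
  fix f ss s vs
  assume f: "map_of (decls N q) f = Some (ss, s)"
    and vs: "list_all2 (\<lambda>v s'. v \<in> sort_dom (canonical n) s') vs ss"
  from f have "(f, (ss, s)) \<in> set base_decls \<or> (\<exists>i p. f = wit i p \<and> s = Str)"
    unfolding decls_def by (auto dest!: map_of_SomeD)
  then show "interp (canonical n) f vs \<in> sort_dom (canonical n) s"
  proof
    assume b: "(f, (ss, s)) \<in> set base_decls"
    then have "interp (canonical n) f vs = base_interp n f vs"
      by (intro interp_canonical) force
    moreover have "base_interp n f vs \<in> sort_dom (canonical n) s"
      using b by (auto simp: base_decls_def base_interp_def intro!: rangeI)
    ultimately show ?thesis by simp
  qed (auto simp: interp_canonical wit_interp_def)
qed (simp_all add: interp_canonical base_decls_def base_interp_def)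

text \<open>The arithmetic equations become recursion laws of the extended naturals, such as
  \<open>mult_eSuc\<close>, which also hold at infinity.\<close>

lemma base_eqns_canonical: "model (canonical n) (set base_eqns)"
proof -
  have "teval (canonical n) \<rho> (fst e) = teval (canonical n) \<rho> (snd e)"
    if "assignment (canonical n) \<rho>" "e \<in> set base_eqns" for \<rho> e
  proof -
    have "\<rho> Bit i \<in> sort_dom (canonical n) Bit" "\<rho> Str i \<in> sort_dom (canonical n) Str" for i
      using that(1) unfolding assignment_def by blast+
    then have "\<rho> Bit i \<in> range BitV" "\<rho> Str i \<in> range StrV" for i by simp_all
    then obtain x y \<sigma> \<tau> where "\<rho> Bit 0 = BitV x" "\<rho> Bit (Suc 0) = BitV y"
      "\<rho> Str 0 = StrV \<sigma>" "\<rho> Str (Suc 0) = StrV \<tau>" by (meson imageE)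
    then show ?thesis
      using that(2) unfolding base_eqns_def Let_def
      by (auto simp: interp_canonical base_decls_def base_interp_def iadd_Suc iadd_Suc_right mult_eSuc
          simp flip: sconst_unfold)
  qed
  then show ?thesis unfolding model_def by auto
qed

lemma base_model_canonical: "base_model (map_of (decls N q)) (canonical n)"
  by unfold_locales
    (simp_all add: stream_algebra_canonical full_canonical base_sig_decls base_eqns_canonical)

text \<open>The two algebras differ only on witness symbols, which do not occur in
  \<open>p\<close>.\<close>

lemma sem_canonical:
  assumes "wf_form base_sig p"
  shows "sem (base_alg n) \<rho> p = sem (canonical n) \<rho> p"
  using assms
proof (rule sem_agree)
  fix f vs assume "f \<in> dom base_sig"
  then show "interp (base_alg n) f vs = interp (canonical n) f vs"
    by (simp add: dom_base_sig interp_canonical base_alg_def)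
qed

lemma wit_interp_correct:
  assumes "wf_form base_sig p" "svars p \<subseteq> {..<N}" "sem (canonical n) (upd \<rho> i (StrV \<sigma>)) p"
  shows "sem (canonical n)
    (upd \<rho> i (wit_interp n i p (map (\<lambda>j. if j = i then StrV (sconst False) else \<rho> Str j) [0..<N]))) p"
proof -
  let ?vs = "map (\<lambda>j. if j = i then StrV (sconst False) else \<rho> Str j) [0..<N]"
  \<comment> \<open>All variables of \<open>p\<close> lie below \<open>N\<close>, so the argument
    list determines its truth; the constant in slot \<open>i\<close> is overwritten by
    \<open>upd\<close>.\<close>
  have eq: "sem (base_alg n) (upd (env ?vs) i (StrV \<sigma>)) p = sem (canonical n) (upd \<rho> i (StrV \<sigma>)) p" for \<sigma>
    unfolding sem_canonical[OF assms(1)]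
    using assms(1) by (rule sem_cong) (use assms(2) in \<open>auto simp: env_def\<close>)
  have "\<exists>\<sigma>. sem (base_alg n) (upd (env ?vs) i (StrV \<sigma>)) p" using assms(3) eq by blast
  then have "sem (base_alg n)
      (upd (env ?vs) i (StrV (SOME \<sigma>. sem (base_alg n) (upd (env ?vs) i (StrV \<sigma>)) p))) p"
    by (rule someI_ex)
  then show ?thesis unfolding eq wit_interp_def .
qed

text \<open>Proved apart from \<open>teval_skolem\<close>, which presupposes the witness equations.
  Here \<open>wit_interp_correct\<close> takes their place, and the equations are derived from the
  result.\<close>

lemma skolem_canonical:
  assumes "wf_form base_sig p" "svars p \<subseteq> {..<N}" "assignment (canonical n) \<rho>"
  shows "teval (canonical n) \<rho> (skolem N p) = BitV (sem (canonical n) \<rho> p)"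
  using assms
proof (induction p arbitrary: \<rho>)
  case (Atom b)
  interpret base_model "map_of (decls N q)" "canonical n" for q by (rule base_model_canonical)
  show ?case using teval_atom Atom by simp
next
  case (Imp p q)
  interpret base_model "map_of (decls N q)" "canonical n" for q by (rule base_model_canonical)
  show ?case using Imp by simp
next
  case (Ex i p)
  interpret base_model "map_of (decls N q)" "canonical n" for q by (rule base_model_canonical)
  let ?w = "wit_interp n i p (map (\<lambda>j. if j = i then StrV (sconst False) else \<rho> Str j) [0..<N])"
  have "teval (canonical n) \<rho> (skolem N (Ex i p)) = teval (canonical n) (upd \<rho> i ?w) (skolem N p)"
    unfolding teval_Ex teval_wit_args interp_canonical ..
  also have "\<dots> = BitV (sem (canonical n) (upd \<rho> i ?w) p)"
    using Ex.prems unfolding wit_interp_def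
    by (intro Ex.IH) (simp_all add: assignment_upd del: upd_simps sort_dom.simps)
  also have "sem (canonical n) (upd \<rho> i ?w) p = sem (canonical n) \<rho> (Ex i p)"
    using wit_interp_correct[of p N n \<rho> i] Ex.prems by (auto simp: wit_interp_def)
  finally show ?case .
qed

lemma exs_subform:
  assumes "(i, p) \<in> set (exs q)" "wf_form \<Sigma> q" "svars q \<subseteq> S"
  shows "wf_form \<Sigma> (Ex i p)" "svars (Ex i p) \<subseteq> S"
  using assms by (induction q) auto

lemma wit_eqns_canonical:
  assumes "wf_form base_sig q" "svars q \<subseteq> {..<N}"
  shows "model (canonical n) (wit_eqn N ` set (exs q))"
proof -
  interpret base_model "map_of (decls N q)" "canonical n" by (rule base_model_canonical)
  have "teval (canonical n) \<rho> (ite_t (skolem N p) (skolem N (Ex i p)) one_t) = teval (canonical n) \<rho> one_t"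
    if "assignment (canonical n) \<rho>" "(i, p) \<in> set (exs q)" for \<rho> i p
  proof -
    have wf: "wf_form base_sig (Ex i p)" "svars (Ex i p) \<subseteq> {..<N}"
      using exs_subform[OF that(2) assms] by simp_all
    have "\<rho> Str i \<in> sort_dom (canonical n) Str" using that(1) unfolding assignment_def by blast
    then obtain \<sigma> where "\<rho> Str i = StrV \<sigma>" by auto
    \<comment> \<open>The current value of variable \<open>i\<close> is itself a solution for the
      existential form.\<close>
    then have "upd \<rho> i (StrV \<sigma>) = \<rho>" by (simp add: upd_def fun_eq_iff)
    then have "sem (canonical n) \<rho> p \<Longrightarrow> sem (canonical n) \<rho> (Ex i p)"
      by (auto intro: exI[of _ \<sigma>])
    then show ?thesis
      using skolem_canonical[OF wf that(1)] skolem_canonical[of p N n \<rho>] wf that(1)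
      by (simp del: skolem.simps sem.simps)
  qed
  then show ?thesis unfolding model_def by auto
qed

lemma model_Un: "model A (E \<union> F) \<longleftrightarrow> model A E \<and> model A F"
  by (auto simp: model_def)

lemma model_insert:
  "model A (insert (l, r) E) \<longleftrightarrow>
     (\<forall>\<rho>. assignment A \<rho> \<longrightarrow> teval A \<rho> l = teval A \<rho> r) \<and> model A E"
  by (auto simp: model_def)

lemma canonical_model:
  assumes "wf_form base_sig q" "svars q \<subseteq> {..<N}"
  shows "model (canonical n) (set (eqns N q n))"
proof -
  interpret base_model "map_of (decls N q)" "canonical n" by (rule base_model_canonical)
  have "teval (canonical n) \<rho> input_t = teval (canonical n) \<rho> (numeral_t n)" for \<rho>
    by (simp add: teval_numeral_t interp_canonical base_decls_def base_interp_def del: unary.simps)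
  with base_eqns_canonical wit_eqns_canonical[OF assms] show ?thesis
    by (simp add: eqns_def model_insert model_Un)
qed

section \<open>The reduction\<close>

text \<open>The substitution mirrors the environments of \<open>defines_set\<close>: number
  variables receive the input, set variables the empty set, whose characteristic stream is
  \<open>zeros_t\<close>.\<close>

definition query_t :: "nat \<Rightarrow> form \<Rightarrow> bterm" where
  "query_t N q = scon_t (sub (\<lambda>i::nat. if even i then input_t else zeros_t) (skolem N q)) zeros_t"

definition spec_half :: "nat \<Rightarrow> form \<Rightarrow> nat \<Rightarrow> bterm \<Rightarrow> half" where
  "spec_half N q n t = (decls N q, eqns N q n, t)"

lemma has_sort_base: "has_sort base_sig t s \<Longrightarrow> has_sort (map_of (decls N q)) t s"
  using has_sort_mono base_sig_decls by blast

section \<open>Sorts and groundness of the instances\<close>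

lemma has_sort_skolem:
  assumes "wf_form base_sig p" "set (exs p) \<subseteq> set (exs q)"
  shows "has_sort (map_of (decls N q)) (skolem N p) Bit"
  using assms
proof (induction p)
  case (Atom b)
  then show ?case using has_sort_base by simp
next
  case (Imp p p')
  moreover have "has_sort base_sig one_t Bit" "base_sig (Fn 0) = Some ([Bit, Bit, Bit], Bit)"
    by (simp_all add: base_decls_def)
  ultimately show ?case using base_sig_decls[of N q] has_sort_base[of one_t Bit N q]
    by (auto simp: map_le_def dom_def simp del: has_sort_App)
      (auto simp: list_all2_Cons2)
next
  case (Ex i p)
  have "has_sort base_sig zeros_t Str" by (simp add: base_decls_def)
  then have "has_sort (map_of (decls N q)) zeros_t Str" by (rule has_sort_base)
  then have "list_all2 (has_sort (map_of (decls N q))) (wit_args N i) (replicate N Str)"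
    by (auto simp: wit_args_def list_all2_conv_all_nth simp del: has_sort_App)
  moreover have "map_of (decls N q) (wit i p) = Some (replicate N Str, Str)"
    using Ex.prems(2) by (simp add: decls_wit)
  ultimately have "has_sort (map_of (decls N q)) (App (wit i p) (wit_args N i)) Str" by simp
  then show ?case using Ex by (simp add: has_sort_sub del: has_sort_App)
qed

text \<open>Hence substituting ground terms for all stream variables, as in \<open>query_t\<close>,
  leaves no variable.\<close>

lemma tvars_skolem: "wf_form base_sig p \<Longrightarrow> (Bit, x) \<notin> tvars (skolem N p)"
proof (induction p arbitrary: x)
  case (Ex i p)
  have "tvars (((Var Str)(i := App (wit i p) (wit_args N i))) j) \<subseteq> {Str} \<times> UNIV" for j
    by (auto simp: wit_args_def split: if_splits)
  with Ex tvars_sub[of "(Var Str)(i := App (wit i p) (wit_args N i))" "skolem N p"]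
  show ?case by auto
qed auto

lemma ground_numeral_t: "has_sort base_sig (numeral_t n) Str"
  by (induction n) (auto simp: base_decls_def)

lemma ground_query_t:
  assumes "wf_form base_sig q"
  shows "ground_term (map_of (decls N q)) (query_t N q) Str"
proof -
  let ?\<theta> = "\<lambda>i::nat. if even i then input_t else zeros_t"
  have "has_sort base_sig (?\<theta> i) Str" for i by (simp add: base_decls_def)
  then have th: "has_sort (map_of (decls N q)) (?\<theta> i) Str" for i using has_sort_base by blast
  then have "has_sort (map_of (decls N q)) (sub ?\<theta> (skolem N q)) Bit"
    by (intro has_sort_sub has_sort_skolem assms order.refl)
  moreover have "map_of (decls N q) SCon = Some ([Bit, Str], Str)"
    using base_sig_decls[of N q] by (auto simp: map_le_def base_decls_def dom_def)
  ultimately have "has_sort (map_of (decls N q)) (query_t N q) Str"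
    using th[of 1] by (simp add: query_t_def)
  moreover have "tvars (query_t N q) = {}"
    using tvars_sub[of ?\<theta> "skolem N q"] tvars_skolem[OF assms] by (auto simp: query_t_def split: if_splits)
  ultimately show ?thesis by (simp add: ground_term_def)
qed

lemma ground_one: "ground_term (map_of (decls N q)) (scon_t one_t zeros_t) Str"
  unfolding ground_term_def
  by (intro conjI has_sort_base) (auto simp: base_decls_def)

lemma valid_spec_half:
  assumes "wf_form base_sig q" "ground_term (map_of (decls N q)) t Str"
  shows "valid_half (spec_half N q n t)"
proof -
  let ?\<Sigma> = "map_of (decls N q)"
  have "bitstream_signature ?\<Sigma>"
    using base_sig_decls[of N q]
    by (auto simp: bitstream_signature_def map_le_def base_decls_def dom_def)
  moreover have "bitstream_spec ?\<Sigma> (set (eqns N q n))"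
  proof -
    have "\<exists>s. has_sort base_sig (fst e) s \<and> has_sort base_sig (snd e) s" if "e \<in> set base_eqns" for e
      using that by (auto simp: base_eqns_def Let_def base_decls_def)
    then have base: "\<exists>s. has_sort ?\<Sigma> (fst e) s \<and> has_sort ?\<Sigma> (snd e) s" if "e \<in> set base_eqns" for e
      using that has_sort_base by blast
    have "has_sort base_sig input_t Str" by (simp add: base_decls_def)
    then have input: "has_sort ?\<Sigma> input_t Str" "has_sort ?\<Sigma> (numeral_t n) Str"
      using ground_numeral_t has_sort_base by blast+
    have wit: "has_sort ?\<Sigma> (fst (wit_eqn N (i, p))) Bit \<and> has_sort ?\<Sigma> (snd (wit_eqn N (i, p))) Bit"
      if "(i, p) \<in> set (exs q)" for i p
    proof -
      have sub: "set (exs (Ex i p)) \<subseteq> set (exs q)" using that by (induction q) auto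
      have "wf_form base_sig (Ex i p)" using exs_subform[OF that assms(1) subset_UNIV] by simp
      \<comment> \<open>The left side of the witness equation is the Skolem term of this
        implication.\<close>
      then have "has_sort ?\<Sigma> (skolem N (Imp p (Ex i p))) Bit"
        using sub by (intro has_sort_skolem) auto
      moreover have "has_sort ?\<Sigma> one_t Bit" by (rule has_sort_base) (simp add: base_decls_def)
      ultimately show ?thesis by (simp only: wit_eqn.simps skolem.simps(2) fst_conv snd_conv)
    qed
    have "\<exists>s. has_sort ?\<Sigma> (fst e) s \<and> has_sort ?\<Sigma> (snd e) s" if "e \<in> set (eqns N q n)" for e
    proof -
      consider "e = (input_t, numeral_t n)" | "e \<in> set base_eqns"
        | i p where "(i, p) \<in> set (exs q)" "e = wit_eqn N (i, p)"
        using \<open>e \<in> set (eqns N q n)\<close> unfolding eqns_def by (auto simp del: wit_eqn.simps)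
      then show ?thesis
      proof cases
        case 1
        with input show ?thesis by (metis fst_conv snd_conv)
      qed (use base wit in blast)+
    qed
    then show ?thesis unfolding bitstream_spec_def by (auto simp del: has_sort_App)
  qed
  ultimately show ?thesis using assms(2) by (simp add: spec_half_def)
qed

lemma Collect_eq_singleton:
  assumes "\<exists>A \<rho>. P A \<rho>" "\<And>A \<rho>. P A \<rho> \<Longrightarrow> f A \<rho> = c"
  shows "{f A \<rho> | A \<rho>. P A \<rho>} = {c}"
  using assms by (auto 0 3) metis

context
  fixes \<phi> :: fm and N :: nat and q :: form
  assumes q: "q = conv \<phi>" and N: "svars q \<subseteq> {..<N}"
begin

lemma teval_query_t:
  assumes "stream_algebra (map_of (decls N q)) A" "full A" "model A (set (eqns N q n))"
    "assignment A \<rho>"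
  shows "teval A \<rho> (query_t N q) = StrV (sat (\<lambda>_. n) (\<lambda>_. {}) \<phi> ## sconst False)"
    and "teval A \<rho> (scon_t one_t zeros_t) = StrV (True ## sconst False)"
proof -
  have mdl: "model A (set base_eqns)" "model A (wit_eqn N ` set (exs q))"
      "teval A \<rho> input_t = teval A \<rho> (numeral_t n)"
    using assms(3,4) by (simp_all add: eqns_def model_insert model_Un)
  interpret base_model "map_of (decls N q)" A
    using assms(1,2) base_sig_decls mdl(1) by unfold_locales
  let ?\<theta> = "\<lambda>i::nat. if even i then input_t else zeros_t"
  let ?\<rho> = "\<rho>(Str := \<lambda>i. teval A \<rho> (?\<theta> i))"
  have \<theta>: "teval A \<rho> (?\<theta> i) = StrV (if even i then unary (enat n) else sconst False)" for i
    using mdl(3) by (simp add: teval_numeral_t del: unary.simps)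
  have "represents ?\<rho> (\<lambda>_. n) (\<lambda>_. {})"
    unfolding represents_def \<theta> by (simp del: unary.simps)
  moreover have "assignment A ?\<rho>"
    unfolding assignment_def
  proof (intro allI)
    fix s x show "?\<rho> s x \<in> sort_dom A s"
      using assms(4) unfolding \<theta> assignment_def by (cases s) (simp_all del: sort_dom.simps)
  qed
  ultimately have "teval A ?\<rho> (skolem N q) = BitV (sat (\<lambda>_. n) (\<lambda>_. {}) \<phi>)"
    using teval_skolem[of q q N ?\<rho>] mdl(2) wf_conv sem_conv decls_wit q by auto
  then show "teval A \<rho> (query_t N q) = StrV (sat (\<lambda>_. n) (\<lambda>_. {}) \<phi> ## sconst False)"
    by (simp add: query_t_def teval_sub)
  show "teval A \<rho> (scon_t one_t zeros_t) = StrV (True ## sconst False)"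
    by simp
qed

text \<open>At most one value occurs by \<open>teval_query_t\<close>, and at least one because
  \<open>canonical n\<close> is a full model.\<close>

lemma half_sol_spec_half:
  "half_sol (spec_half N q n (query_t N q)) = {StrV (sat (\<lambda>_. n) (\<lambda>_. {}) \<phi> ## sconst False)}"
  "half_sol (spec_half N q n (scon_t one_t zeros_t)) = {StrV (True ## sconst False)}"
proof -
  have "assignment (canonical n) (\<lambda>s x. case s of Bit \<Rightarrow> BitV False | Str \<Rightarrow> StrV (sconst False))"
    unfolding assignment_def
  proof (intro allI)
    fix s and x :: nat
    show "(case s of Bit \<Rightarrow> BitV False | Str \<Rightarrow> StrV (sconst False)) \<in> sort_dom (canonical n) s"
      by (cases s) auto
  qed
  then have ex: "\<exists>A \<rho>. stream_algebra (map_of (decls N q)) A \<and> full A \<and>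
      model A (set (eqns N q n)) \<and> assignment A \<rho>"
    using stream_algebra_canonical full_canonical canonical_model wf_conv N unfolding q by blast
  then show "half_sol (spec_half N q n (query_t N q)) =
      {StrV (sat (\<lambda>_. n) (\<lambda>_. {}) \<phi> ## sconst False)}"
    unfolding spec_half_def half_sol.simps sol_full_def
    by (rule Collect_eq_singleton) (use teval_query_t(1) in blast)
  from ex show "half_sol (spec_half N q n (scon_t one_t zeros_t)) = {StrV (True ## sconst False)}"
    unfolding spec_half_def half_sol.simps sol_full_def
    by (rule Collect_eq_singleton) (use teval_query_t(2) in blast)
qed

end

section \<open>Recursiveness of the instance code and the final reduction\<close>

lemma instance_code_in_full_sol_equality:
  "instance_code (I, J) \<in> full_sol_equality \<longleftrightarrow>
     valid_half I \<and> valid_half J \<and> half_sol I = half_sol J"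
  by (simp only: full_sol_equality_def mem_Collect_eq inj_eq[OF inj_instance_code] prod.inject) blast

text \<open>Prefixing a one acts on codes as a fixed recursive function, which is then
  iterated.\<close>

lemma recursive1_numeral_code: "recursive1 (\<lambda>n. term_code (numeral_t n))"
proof -
  \<comment> \<open>\<open>2\<close> is the code of \<open>SCon\<close>, the nested pairs encode its
    two arguments as a list, and \<open>Suc (b + b)\<close> is
    \<open>sum_encode (Inr b)\<close>.\<close>
  let ?step = "\<lambda>x. Suc (prod_encode (2, Suc (prod_encode (term_code one_t, Suc (prod_encode (x, 0)))))
      + prod_encode (2, Suc (prod_encode (term_code one_t, Suc (prod_encode (x, 0))))))"
  have "term_code (numeral_t n) = (?step ^^ n) (term_code zeros_t)" for n
    by (induction n) (simp_all add: sum_encode_def del: term_code.simps add: term_code.simps(2)[of SCon])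
  moreover have "recursive1 ?step"
    by (intro recursive1_Suc recursive1_plus recursive1_prod_encode recursive1_const recursive1_id)
  ultimately show ?thesis using recursive1_iterate by simp
qed

text \<open>Only the head equation varies with \<open>n\<close>; all else in the code is
  constant.\<close>

lemma recursive1_half_code: "recursive1 (\<lambda>n. half_code (spec_half N q n t))"
  unfolding spec_half_def eqns_def half_code.simps list.map eqn_code.simps list_encode.simps
  by (intro recursive1_Suc recursive1_prod_encode recursive1_numeral_code recursive1_const)

theorem theorem5:
  fixes X :: "nat set" and n :: nat
  assumes "X \<in> Sigma1 n \<or> X \<in> Pi1 n"
  shows "X \<le>\<^sub>m full_sol_equality"
proof -
  obtain \<phi> where "defines_set \<phi> X"
    using assms unfolding Sigma1_def Pi1_def by blast
  then have X: "k \<in> X \<longleftrightarrow> sat (\<lambda>_. k) (\<lambda>_. {}) \<phi>" for k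
    by (simp add: defines_set_def)
  define q where "q = conv \<phi>"
  \<comment> \<open>Witnesses must be able to depend on every variable of \<open>q\<close>, so
    \<open>N\<close> exceeds all indices.\<close>
  obtain N where N: "svars q \<subseteq> {..<N}"
    using finite_nat_bounded[OF finite_svars] by blast
  let ?I = "\<lambda>k. spec_half N q k (query_t N q)"
  let ?J = "\<lambda>k. spec_half N q k (scon_t one_t zeros_t)"
  let ?f = "\<lambda>k. instance_code (?I k, ?J k)"
  have "?f = (\<lambda>k. prod_encode (half_code (?I k), half_code (?J k)))"
    by (simp add: instance_code_def)
  then have "recursive1 ?f"
    using recursive1_prod_encode[OF recursive1_half_code recursive1_half_code] by simp
  moreover have "k \<in> X \<longleftrightarrow> ?f k \<in> full_sol_equality" for k
  proof -
    have wf: "wf_form base_sig q" unfolding q_def by (rule wf_conv)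
    have "valid_half (?I k)" "valid_half (?J k)"
      using valid_spec_half[OF wf] ground_query_t[OF wf] ground_one by blast+
    \<comment> \<open>Both sides are singletons that can differ only in the first bit, the truth
      value of the formula against \<open>True\<close>.\<close>
    moreover have "half_sol (?I k) = half_sol (?J k) \<longleftrightarrow> k \<in> X"
      unfolding half_sol_spec_half[OF q_def N] X by simp
    ultimately show ?thesis
      unfolding instance_code_in_full_sol_equality by simp
  qed
  ultimately show ?thesis
    unfolding many_one_reducible_def using partial_recursive_Some by blast
qed

end
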